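(* In the single-buyer-type setting described in the context, with targeted type $\theta$, the seller's optimal expected revenue (per buyer) is equal to the value at the point $\theta$ of the concave closure of the function $$f(\eta)=R(\eta)\cdot C(\eta),\qquad \eta\in\Delta\Omega .$$ More formally, finding the optimal advertising rule is equivalent to solving the optimization problem $$\max_{S,\,(\eta^s)_{s\in S},\,(\phi_s)_{s\in S}}\ \sum_{s\in S}\phi_s\, R(\eta^s)\,C(\eta^s)\quad\text{s.t.}\quad \sum_{s\in S}\phi_s\,\eta^s=\theta,\quad \phi_s\ge 0,\ \eta^s\in\Delta\Omega\ \ \forall s\in S,$$ where $S$ ranges over finite sets, and where a solution $(S,(\eta^s),(\phi_s))$ represents the advertising rule with $\pi(\omega,s)=\phi_s\,\eta^s_\omega/\theta_\omega$ for all $\omega\in\Omega$, $s\in S$, and $p_s=C(\eta^s)$ for all $s\in S$.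
   Context: Setting (single buyer type). $\Omega=\{1,\dots,n\}$ is the finite set of states of the world, $\mu\in\Delta\Omega$ is the distribution of the state $\omega$, and $\Delta\Omega$ denotes the set of probability distributions on $\Omega$. There is a finite action set $A$ and a utility function $u:\Omega\times A\to[0,1]$. The buyer has type (personal prior belief) $\theta\in\Delta\Omega$ with $\theta_\omega>0$ for all $\omega$; $\theta$ may differ from $\mu$. An advertising rule $\langle S,\pi,\{p_s:s\in S\}\rangle$ consists of a finite signal set $S$, a signaling scheme $\pi:\Omega\to\Delta S$ (signal $s$ is sent with probability $\pi(\omega,s)$ in state $\omega$), and a price $p_s\in\mathbb{R}$ for each $s\in S$ at which the full revelation of $\omega$ is offered after $s$ is sent. The buyer's posterior after $s$ is $\eta^s$ with $\eta^s_\omega=\theta_\omega\pi(\omega,s)/\sum_{\omega'}\theta_{\omega'}\pi(\omega',s)$. Cost of uncertainty: $C(\eta)=\sum_\omega \eta_\omega\max_{a\in A}u(\omega,a)-\max_{a\in A}\sum_\omega\eta_\omega u(\omega,a)$ for $\eta\in\Delta\Omega$. The buyer purchases after $s$ if and only if $C(\eta^s)\ge p_s$. The seller's expected revenue is $\sum_{\omega}\mu_\omega\sum_{s\in S}\pi(\omega,s)\,p_s\,\mathbf 1(C(\eta^s)\ge p_s)$ (signals with $\pi(\cdot,s)\equiv 0$ contribute nothing); an advertising rule is optimal if it maximizes this revenue over all advertising rules. Likelihood ratio: $R(\eta)=\sum_\omega \mu_\omega\eta_\omega/\theta_\omega$ for $\eta\in\Delta\Omega$. The concave closure of $f:\Delta\Omega\to\mathbb{R}$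 is the smallest concave function on $\Delta\Omega$ that is pointwise at least $f$. *)

theory Defs
  imports "HOL-Analysis.Analysis" "HOL-Library.Infinite_Typeclass"
begin

text \<open>The states are the elements of a finite type \<open>'n\<close>, and beliefs are vectors in
  \<open>real^'n\<close>. Signals are labelled by elements of an arbitrary infinite type \<open>'s\<close>, so that finite
  signal sets of every size are available; schemes and prices are total functions of which only
  the values on the signal set \<open>S\<close> matter.\<close>

definition prob_simplex :: "(real^'n) set" where
  "prob_simplex = {\<eta>. (\<forall>\<omega>. 0 \<le> \<eta> $ \<omega>) \<and> (\<Sum>\<omega>\<in>UNIV. \<eta> $ \<omega>) = 1}"

definition cost :: "'a set \<Rightarrow> ('n \<Rightarrow> 'a \<Rightarrow> real) \<Rightarrow> real^'n \<Rightarrow> real" where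
  "cost A u \<eta> = (\<Sum>\<omega>\<in>UNIV. \<eta> $ \<omega> * (MAX a\<in>A. u \<omega> a)) - (MAX a\<in>A. \<Sum>\<omega>\<in>UNIV. \<eta> $ \<omega> * u \<omega> a)"

definition likelihood_ratio :: "real^'n \<Rightarrow> real^'n \<Rightarrow> real^'n \<Rightarrow> real" where
  "likelihood_ratio \<mu> \<theta> \<eta> = (\<Sum>\<omega>\<in>UNIV. \<mu> $ \<omega> * \<eta> $ \<omega> / \<theta> $ \<omega>)"

text \<open>Prices are arbitrary reals, so admissibility of a rule \<open>(S, \<pi>, p)\<close> only constrains
  \<open>S\<close> and \<open>\<pi>\<close>.\<close>

definition advertising_rule :: "'s set \<Rightarrow> ('n \<Rightarrow> 's \<Rightarrow> real) \<Rightarrow> ('s \<Rightarrow> real) \<Rightarrow> bool" where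
  "advertising_rule S \<pi> p \<longleftrightarrow>
     finite S \<and> (\<forall>\<omega>. (\<forall>s\<in>S. 0 \<le> \<pi> \<omega> s) \<and> (\<Sum>s\<in>S. \<pi> \<omega> s) = 1)"

text \<open>If signal \<open>s\<close> is never sent, the denominator is 0 and the posterior is the zero vector;
  such a signal does not contribute to the revenue below.\<close>

definition posterior :: "real^'n \<Rightarrow> ('n \<Rightarrow> 's \<Rightarrow> real) \<Rightarrow> 's \<Rightarrow> real^'n" where
  "posterior \<theta> \<pi> s = (\<chi> \<omega>. \<theta> $ \<omega> * \<pi> \<omega> s / (\<Sum>\<omega>'\<in>UNIV. \<theta> $ \<omega>' * \<pi> \<omega>' s))"

definition revenue :: "real^'n \<Rightarrow> real^'n \<Rightarrow> 'a set \<Rightarrow> ('n \<Rightarrow> 'a \<Rightarrow> real) \<Rightarrow>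
    's set \<Rightarrow> ('n \<Rightarrow> 's \<Rightarrow> real) \<Rightarrow> ('s \<Rightarrow> real) \<Rightarrow> real" where
  "revenue \<mu> \<theta> A u S \<pi> p =
     (\<Sum>\<omega>\<in>UNIV. \<mu> $ \<omega> * (\<Sum>s\<in>S. \<pi> \<omega> s * p s * of_bool (cost A u (posterior \<theta> \<pi> s) \<ge> p s)))"

definition optimal_rule :: "real^'n \<Rightarrow> real^'n \<Rightarrow> 'a set \<Rightarrow> ('n \<Rightarrow> 'a \<Rightarrow> real) \<Rightarrow>
    's set \<Rightarrow> ('n \<Rightarrow> 's \<Rightarrow> real) \<Rightarrow> ('s \<Rightarrow> real) \<Rightarrow> bool" where
  "optimal_rule \<mu> \<theta> A u S \<pi> p \<longleftrightarrow> advertising_rule S \<pi> p \<and>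
     (\<forall>(S' :: 's set) \<pi>' p'. advertising_rule S' \<pi>' p' \<longrightarrow>
        revenue \<mu> \<theta> A u S' \<pi>' p' \<le> revenue \<mu> \<theta> A u S \<pi> p)"

text \<open>Only the values of \<open>F\<close> on \<open>D\<close> are determined; there \<open>F\<close> is unique.\<close>

definition is_concave_closure_on ::
    "'v::real_vector set \<Rightarrow> ('v \<Rightarrow> real) \<Rightarrow> ('v \<Rightarrow> real) \<Rightarrow> bool" where
  "is_concave_closure_on D f F \<longleftrightarrow>
     concave_on D F \<and> (\<forall>x\<in>D. f x \<le> F x) \<and>
     (\<forall>g. concave_on D g \<longrightarrow> (\<forall>x\<in>D. f x \<le> g x) \<longrightarrow> (\<forall>x\<in>D. F x \<le> g x))"

lemma is_concave_closure_on_unique: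
  "is_concave_closure_on D f F \<Longrightarrow> is_concave_closure_on D f G \<Longrightarrow> x \<in> D \<Longrightarrow> F x = G x"
  unfolding is_concave_closure_on_def by (meson order_antisym)

definition feasible :: "real^'n \<Rightarrow> 's set \<Rightarrow> ('s \<Rightarrow> real^'n) \<Rightarrow> ('s \<Rightarrow> real) \<Rightarrow> bool" where
  "feasible \<theta> S \<eta> \<phi> \<longleftrightarrow>
     finite S \<and> (\<Sum>s\<in>S. \<phi> s *\<^sub>R \<eta> s) = \<theta> \<and> (\<forall>s\<in>S. 0 \<le> \<phi> s \<and> \<eta> s \<in> prob_simplex)"

definition objective :: "real^'n \<Rightarrow> real^'n \<Rightarrow> 'a set \<Rightarrow> ('n \<Rightarrow> 'a \<Rightarrow> real) \<Rightarrow>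
    's set \<Rightarrow> ('s \<Rightarrow> real^'n) \<Rightarrow> ('s \<Rightarrow> real) \<Rightarrow> real" where
  "objective \<mu> \<theta> A u S \<eta> \<phi> = (\<Sum>s\<in>S. \<phi> s * likelihood_ratio \<mu> \<theta> (\<eta> s) * cost A u (\<eta> s))"

definition solution :: "real^'n \<Rightarrow> real^'n \<Rightarrow> 'a set \<Rightarrow> ('n \<Rightarrow> 'a \<Rightarrow> real) \<Rightarrow>
    's set \<Rightarrow> ('s \<Rightarrow> real^'n) \<Rightarrow> ('s \<Rightarrow> real) \<Rightarrow> bool" where
  "solution \<mu> \<theta> A u S \<eta> \<phi> \<longleftrightarrow> feasible \<theta> S \<eta> \<phi> \<and>
     (\<forall>(S' :: 's set) \<eta>' \<phi>'. feasible \<theta> S' \<eta>' \<phi>' \<longrightarrow>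
        objective \<mu> \<theta> A u S' \<eta>' \<phi>' \<le> objective \<mu> \<theta> A u S \<eta> \<phi>)"

definition induced_scheme ::
    "real^'n \<Rightarrow> ('s \<Rightarrow> real^'n) \<Rightarrow> ('s \<Rightarrow> real) \<Rightarrow> 'n \<Rightarrow> 's \<Rightarrow> real" where
  "induced_scheme \<theta> \<eta> \<phi> \<omega> s = \<phi> s * \<eta> s $ \<omega> / \<theta> $ \<omega>"

definition induced_price ::
    "'a set \<Rightarrow> ('n \<Rightarrow> 'a \<Rightarrow> real) \<Rightarrow> ('s \<Rightarrow> real^'n) \<Rightarrow> 's \<Rightarrow> real" where
  "induced_price A u \<eta> s = cost A u (\<eta> s)"

end

theory Submission imports Defs begin

text \<open>Concavification: a signaling scheme amounts to a decomposition of \<open>\<theta>\<close> into posteriors, where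
  \<open>\<phi>\<close> is the probability of a signal in the eyes of the buyer; the factor \<open>R\<close> converts it into the
  probability under \<open>\<mu>\<close>. After each signal the best price is the cost of uncertainty, so the revenue
  of a decomposition is an average of values of \<open>R \<cdot> C\<close>. The pairs (barycentre, average value) fill the
  convex hull of the graph of \<open>R \<cdot> C\<close>; it is compact because the function is continuous, and its
  upper boundary is the concave closure, so that the optimum is attained.\<close>

section \<open>Concave closures of continuous functions\<close>

lemma continuous_on_Max:
  fixes g :: "'i \<Rightarrow> 'v::topological_space \<Rightarrow> real"
  assumes "finite A" "A \<noteq> {}" "\<And>a. a \<in> A \<Longrightarrow> continuous_on D (g a)"
  shows "continuous_on D (\<lambda>x. MAX a\<in>A. g a x)"
  using assms
proof (induction A rule: finite_ne_induct)
  case (insert a A)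
  then have "continuous_on D (\<lambda>x. max (g a x) (MAX b\<in>A. g b x))"
    by (intro continuous_on_max) auto
  with insert.hyps show ?case by simp
qed simp

text \<open>This serves to compare the hull of a graph with an arbitrary concave majorant: a convex
  hypograph that contains the graph contains its hull.\<close>

lemma convex_hypograph_of_concave_on:
  assumes "concave_on D g"
  shows "convex {(x, y). x \<in> D \<and> y \<le> g x}"
proof (rule convexI)
  fix z1 z2 and u v :: real
  assume "z1 \<in> {(x, y). x \<in> D \<and> y \<le> g x}" "z2 \<in> {(x, y). x \<in> D \<and> y \<le> g x}"
    and "0 \<le> u" "0 \<le> v" "u + v = 1"
  then obtain x1 y1 x2 y2 where z: "z1 = (x1, y1)" "z2 = (x2, y2)"
    and *: "x1 \<in> D" "x2 \<in> D" "y1 \<le> g x1" "y2 \<le> g x2" "0 \<le> u" "0 \<le> v" "u + v = 1"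
    by auto
  have "u *\<^sub>R x1 + v *\<^sub>R x2 \<in> D"
    using * assms by (simp add: concave_on_iff convex_def)
  moreover have "u * y1 + v * y2 \<le> u * g x1 + v * g x2"
    using * by (intro add_mono mult_left_mono)
  moreover have "u * g x1 + v * g x2 \<le> g (u *\<^sub>R x1 + v *\<^sub>R x2)"
    using * assms by (simp add: concave_on_iff)
  ultimately show "u *\<^sub>R z1 + v *\<^sub>R z2 \<in> {(x, y). x \<in> D \<and> y \<le> g x}"
    by (simp add: z)
qed

text \<open>Take for \<open>F x\<close> the greatest height of the hull above \<open>x\<close>.
  Having \<open>(x, F x)\<close> in \<open>H\<close>, and not only a supremum, is what later yields
  an optimal finite decomposition.\<close>

lemma concave_closure_attained:
  fixes f :: "'v::euclidean_space \<Rightarrow> real"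
  assumes "compact D" "convex D" "continuous_on D f"
  defines "H \<equiv> convex hull ((\<lambda>x. (x, f x)) ` D)"
  shows "\<exists>F. is_concave_closure_on D f F \<and> (\<forall>x\<in>D. (x, F x) \<in> H) \<and>
    (\<forall>x y. (x, y) \<in> H \<longrightarrow> y \<le> F x)"
proof -
  have "compact H"
    unfolding H_def using assms
    by (intro compact_convex_hull compact_continuous_image continuous_intros)
  have "convex H" unfolding H_def by simp
  have graph: "(x, f x) \<in> H" if "x \<in> D" for x
    unfolding H_def using that by (intro hull_inc) auto
  have "H \<subseteq> D \<times> UNIV"
    unfolding H_def using \<open>convex D\<close> by (intro hull_minimal) (auto intro: convex_Times)
  have "\<exists>y. (x, y) \<in> H \<and> (\<forall>y'. (x, y') \<in> H \<longrightarrow> y' \<le> y)" if "x \<in> D" for x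
  proof -
    \<comment> \<open>The vertical slice of the hull above \<open>x\<close> is compact and contains
      the graph point, so its heights have a maximum.\<close>
    have "compact (H \<inter> {x} \<times> UNIV)"
      using \<open>compact H\<close> by (intro compact_Int_closed closed_Times) auto
    then have "compact (snd ` (H \<inter> {x} \<times> UNIV))"
      by (intro compact_continuous_image continuous_intros)
    moreover have "snd ` (H \<inter> {x} \<times> UNIV) \<noteq> {}"
      using graph[OF that] by auto
    ultimately obtain y where "y \<in> snd ` (H \<inter> {x} \<times> UNIV)"
      "\<forall>y'\<in>snd ` (H \<inter> {x} \<times> UNIV). y' \<le> y"
      using compact_attains_sup by metis
    then show ?thesis by force
  qed
  then obtain F where F: "\<And>x. x \<in> D \<Longrightarrow> (x, F x) \<in> H"
    "\<And>x y. x \<in> D \<Longrightarrow> (x, y) \<in> H \<Longrightarrow> y \<le> F x"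
    by metis
  have "concave_on D F"
    unfolding concave_on_iff
  proof (intro conjI ballI allI impI)
    fix x y and u v :: real
    assume *: "x \<in> D" "y \<in> D" "0 \<le> u" "0 \<le> v" "u + v = 1"
    \<comment> \<open>The chord between two top points stays in the hull, hence below the top at the
      intermediate point.\<close>
    have "u *\<^sub>R (x, F x) + v *\<^sub>R (y, F y) \<in> H"
      using * F(1) \<open>convex H\<close> by (simp only: convex_def)
    then show "u * F x + v * F y \<le> F (u *\<^sub>R x + v *\<^sub>R y)"
      using F(2) \<open>H \<subseteq> D \<times> UNIV\<close> by auto
  qed fact
  moreover have "F x \<le> g x" if "concave_on D g" "\<forall>x\<in>D. f x \<le> g x" "x \<in> D" for g x
  proof -
    have "H \<subseteq> {(x, y). x \<in> D \<and> y \<le> g x}"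
      unfolding H_def using that by (intro hull_minimal convex_hypograph_of_concave_on) auto
    then show ?thesis using F(1) that(3) by auto
  qed
  ultimately have "is_concave_closure_on D f F"
    unfolding is_concave_closure_on_def using graph F(2) by blast
  then show ?thesis
    using F \<open>H \<subseteq> D \<times> UNIV\<close> by (intro exI[of _ F]) auto
qed

text \<open>The explicit description of the hull sums over a finite set of points, whereas
  decompositions are indexed by signals. An infinite type has finite subsets of every size, so a
  bijection relabels the points.\<close>

lemma convex_hull_indexed_by_infinite_type:
  fixes P :: "'v::real_vector set"
  assumes "x \<in> convex hull P"
  shows "\<exists>(S :: 's::infinite set) w y. finite S \<and> (\<forall>s\<in>S. 0 \<le> w s \<and> y s \<in> P) \<and>
    sum w S = 1 \<and> (\<Sum>s\<in>S. w s *\<^sub>R y s) = x"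
proof -
  obtain T u where T: "finite T" "T \<subseteq> P" "\<forall>v\<in>T. 0 \<le> u v" "sum u T = 1" "(\<Sum>v\<in>T. u v *\<^sub>R v) = x"
    using assms unfolding convex_hull_explicit by blast
  obtain S :: "'s set" where "finite S" "card S = card T"
    using infinite_arbitrarily_large[OF infinite_UNIV] by metis
  then obtain h where h: "bij_betw h S T"
    using T(1) by (metis finite_same_card_bij)
  have "\<forall>s\<in>S. 0 \<le> u (h s) \<and> h s \<in> P"
    using T(2,3) bij_betwE[OF h] by auto
  moreover have "(\<Sum>s\<in>S. u (h s)) = 1" "(\<Sum>s\<in>S. u (h s) *\<^sub>R h s) = x"
    using T(4,5) sum.reindex_bij_betw[OF h, of u] sum.reindex_bij_betw[OF h, of "\<lambda>v. u v *\<^sub>R v"]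
    by auto
  ultimately show ?thesis
    using \<open>finite S\<close> by (intro exI[of _ S] exI[of _ "\<lambda>s. u (h s)"] exI[of _ h]) simp
qed

section \<open>Beliefs and the cost of uncertainty\<close>

lemma prob_simplexD:
  assumes "\<eta> \<in> prob_simplex"
  shows "0 \<le> \<eta> $ \<omega>" "(\<Sum>\<omega>\<in>UNIV. \<eta> $ \<omega>) = 1"
  using assms by (auto simp: prob_simplex_def)

lemma convex_prob_simplex: "convex prob_simplex"
  by (auto simp: convex_def prob_simplex_def sum.distrib simp flip: sum_distrib_left)

lemma compact_prob_simplex: "compact (prob_simplex :: (real^'n) set)"
proof -
  have "closed (prob_simplex :: (real^'n) set)"
    unfolding prob_simplex_def
    by (intro closed_Collect_conj closed_Collect_all closed_Collect_le closed_Collect_eq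
        continuous_intros)
  moreover have "norm \<eta> \<le> 1" if "\<eta> \<in> prob_simplex" for \<eta> :: "real^'n"
    using norm_le_l1_cart[of \<eta>] prob_simplexD[OF that] by simp
  then have "bounded (prob_simplex :: (real^'n) set)"
    by (auto simp: bounded_iff)
  ultimately show ?thesis by (simp add: compact_eq_bounded_closed)
qed

text \<open>Knowing the state never hurts: each action is bounded state by state by the best action
  there.\<close>

lemma cost_nonneg:
  assumes "\<And>\<omega>. 0 \<le> \<eta> $ \<omega>" "finite A" "A \<noteq> {}"
  shows "0 \<le> cost A u \<eta>"
  unfolding cost_def using assms by (auto intro!: sum_mono mult_left_mono)

lemma continuous_on_cost:
  assumes "finite A" "A \<noteq> {}"
  shows "continuous_on D (cost A u)"
  unfolding cost_def[abs_def] using assms by (intro continuous_intros continuous_on_Max)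

lemma continuous_on_likelihood_ratio: "continuous_on D (likelihood_ratio \<mu> \<theta>)"
  unfolding likelihood_ratio_def[abs_def] by (auto intro!: continuous_intros simp: divide_inverse)

section \<open>Advertising rules and decompositions of the prior\<close>

text \<open>Exchanging the sums isolates the seller's probability of each signal, so that revenue
  and objective can be compared signal by signal.\<close>

lemma revenue_by_signal:
  "revenue \<mu> \<theta> A u S \<pi> p =
     (\<Sum>s\<in>S. (\<Sum>\<omega>\<in>UNIV. \<mu> $ \<omega> * \<pi> \<omega> s) * (p s * of_bool (cost A u (posterior \<theta> \<pi> s) \<ge> p s)))"
  unfolding revenue_def sum_distrib_left sum_distrib_right
  by (subst sum.swap) (simp add: mult_ac)

text \<open>Change of measure: the ratios of \<mu> to \<theta> reweight the buyer's probabilities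
  into the seller's, and their average under \<open>\<eta> s\<close> is R.\<close>

lemma sum_induced_scheme:
  "(\<Sum>\<omega>\<in>UNIV. \<mu> $ \<omega> * induced_scheme \<theta> \<eta> \<phi> \<omega> s) = \<phi> s * likelihood_ratio \<mu> \<theta> (\<eta> s)"
  by (simp add: induced_scheme_def likelihood_ratio_def sum_distrib_left mult_ac)

text \<open>The prior cancels in Bayes' rule, leaving the weights
  \<open>\<phi> s * \<eta> s $ \<omega>\<close>, whose total is \<open>\<phi> s\<close>. At
  \<open>\<phi> s = 0\<close> the posterior would be the zero vector instead.\<close>

lemma posterior_induced_scheme:
  assumes "\<forall>\<omega>. 0 < \<theta> $ \<omega>" "\<eta> s \<in> prob_simplex" "\<phi> s \<noteq> 0"
  shows "posterior \<theta> (induced_scheme \<theta> \<eta> \<phi>) s = \<eta> s"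
proof -
  have "\<theta> $ \<omega> * induced_scheme \<theta> \<eta> \<phi> \<omega> s = \<phi> s * \<eta> s $ \<omega>" for \<omega>
    using assms(1) by (simp add: induced_scheme_def order_less_imp_not_eq2)
  then show ?thesis
    using assms(3) prob_simplexD(2)[OF assms(2)]
    by (simp add: posterior_def vec_eq_iff flip: sum_distrib_left)
qed

lemma advertising_rule_induced:
  assumes "\<forall>\<omega>. 0 < \<theta> $ \<omega>" "feasible \<theta> S \<eta> \<phi>"
  shows "advertising_rule S (induced_scheme \<theta> \<eta> \<phi>) p"
proof -
  have "(\<Sum>s\<in>S. induced_scheme \<theta> \<eta> \<phi> \<omega> s) = 1" for \<omega>
  proof -
    have "(\<Sum>s\<in>S. \<phi> s * \<eta> s $ \<omega>) = (\<Sum>s\<in>S. \<phi> s *\<^sub>R \<eta> s) $ \<omega>" by simp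
    also have "\<dots> = \<theta> $ \<omega>" using assms(2) by (simp add: feasible_def)
    finally show ?thesis
      using assms(1) by (simp add: induced_scheme_def order_less_imp_not_eq2 flip: sum_divide_distrib)
  qed
  moreover have "0 \<le> induced_scheme \<theta> \<eta> \<phi> \<omega> s" if "s \<in> S" for \<omega> s
    using assms that by (simp add: induced_scheme_def feasible_def prob_simplexD less_imp_le)
  ultimately show ?thesis
    using assms(2) by (simp add: advertising_rule_def feasible_def)
qed

text \<open>At a price equal to the cost the buyer is indifferent, and ties count as purchases. A
  signal with \<open>\<phi> s = 0\<close> contributes nothing to either side, whatever its
  posterior.\<close>

lemma revenue_induced:
  assumes "\<forall>\<omega>. 0 < \<theta> $ \<omega>" "feasible \<theta> S \<eta> \<phi>"
  shows "revenue \<mu> \<theta> A u S (induced_scheme \<theta> \<eta> \<phi>) (induced_price A u \<eta>)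
    = objective \<mu> \<theta> A u S \<eta> \<phi>"
  unfolding revenue_by_signal objective_def sum_induced_scheme
proof (rule sum.cong)
  fix s assume "s \<in> S"
  then have "\<eta> s \<in> prob_simplex" using assms(2) by (simp add: feasible_def)
  then show "\<phi> s * likelihood_ratio \<mu> \<theta> (\<eta> s) * (induced_price A u \<eta> s *
      of_bool (induced_price A u \<eta> s \<le> cost A u (posterior \<theta> (induced_scheme \<theta> \<eta> \<phi>) s)))
    = \<phi> s * likelihood_ratio \<mu> \<theta> (\<eta> s) * cost A u (\<eta> s)"
    using posterior_induced_scheme[OF assms(1), of \<eta> s \<phi>]
    by (cases "\<phi> s = 0") (auto simp: induced_price_def)
qed simp

text \<open>Bayes' rule splits the prior into posteriors weighted by the buyer's signal
  probabilities. Revenue is only bounded by the objective, since a given price may lie below the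
  cost, or above it and be refused.\<close>

lemma feasible_of_advertising_rule:
  assumes "\<mu> \<in> prob_simplex" "\<theta> \<in> prob_simplex" "\<forall>\<omega>. 0 < \<theta> $ \<omega>" "finite A" "A \<noteq> {}"
    and rule: "advertising_rule S \<pi> p"
  shows "\<exists>\<eta> \<phi>. feasible \<theta> S \<eta> \<phi> \<and>
    (\<forall>\<omega>. \<forall>s\<in>S. \<pi> \<omega> s = induced_scheme \<theta> \<eta> \<phi> \<omega> s) \<and>
    revenue \<mu> \<theta> A u S \<pi> p \<le> objective \<mu> \<theta> A u S \<eta> \<phi>"
proof -
  define \<phi> where "\<phi> = (\<lambda>s. \<Sum>\<omega>\<in>UNIV. \<theta> $ \<omega> * \<pi> \<omega> s)"
  \<comment> \<open>Signals that are never sent need an arbitrary posterior inside the simplex.\<close>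
  define \<eta> where "\<eta> = (\<lambda>s. if \<phi> s = 0 then \<theta> else posterior \<theta> \<pi> s)"
  have \<pi>: "finite S" "\<And>\<omega> s. s \<in> S \<Longrightarrow> 0 \<le> \<pi> \<omega> s" "\<And>\<omega>. (\<Sum>s\<in>S. \<pi> \<omega> s) = 1"
    using rule by (auto simp: advertising_rule_def)
  have term_nonneg: "0 \<le> \<theta> $ \<omega> * \<pi> \<omega> s" if "s \<in> S" for \<omega> s
    using that \<pi>(2) assms(3) by (simp add: less_imp_le)
  then have \<phi>_nonneg: "0 \<le> \<phi> s" if "s \<in> S" for s
    unfolding \<phi>_def using that by (intro sum_nonneg)
  have weighted: "\<phi> s * \<eta> s $ \<omega> = \<theta> $ \<omega> * \<pi> \<omega> s" if "s \<in> S" for s \<omega>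
  proof (cases "\<phi> s = 0")
    case True
    \<comment> \<open>A vanishing sum of nonnegative terms vanishes termwise, so the identity
      survives the default choice of \<open>\<eta> s\<close>.\<close>
    then have "\<theta> $ \<omega> * \<pi> \<omega> s = 0"
      unfolding \<phi>_def using term_nonneg[OF that] by (simp add: sum_nonneg_eq_0_iff)
    with True show ?thesis by simp
  next
    case False
    then show ?thesis by (simp add: \<eta>_def posterior_def flip: \<phi>_def[THEN fun_cong])
  qed
  have simplex: "\<eta> s \<in> prob_simplex" if "s \<in> S" for s
  proof (cases "\<phi> s = 0")
    case True
    then show ?thesis using assms(2) by (simp add: \<eta>_def)
  next
    case False
    have "0 \<le> \<eta> s $ \<omega>" for \<omega>
      using False \<phi>_nonneg[OF that] term_nonneg[OF that]
      by (simp add: \<eta>_def posterior_def flip: \<phi>_def[THEN fun_cong])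
    \<comment> \<open>Cancelling the nonzero \<open>\<phi> s\<close> gives total mass 1.\<close>
    moreover have "\<phi> s * (\<Sum>\<omega>\<in>UNIV. \<eta> s $ \<omega>) = \<phi> s"
      unfolding sum_distrib_left by (simp add: weighted[OF that]) (simp add: \<phi>_def)
    ultimately show ?thesis using False by (simp add: prob_simplex_def)
  qed
  have "(\<Sum>s\<in>S. \<phi> s *\<^sub>R \<eta> s) = \<theta>"
    using \<pi>(3) by (simp add: vec_eq_iff weighted flip: sum_distrib_left)
  then have feasible: "feasible \<theta> S \<eta> \<phi>"
    using \<pi>(1) \<phi>_nonneg simplex by (simp add: feasible_def)
  have scheme: "\<pi> \<omega> s = induced_scheme \<theta> \<eta> \<phi> \<omega> s" if "s \<in> S" for \<omega> s
    using assms(3) by (simp add: induced_scheme_def weighted[OF that] order_less_imp_not_eq2)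
  have "revenue \<mu> \<theta> A u S \<pi> p \<le> objective \<mu> \<theta> A u S \<eta> \<phi>"
    unfolding revenue_by_signal objective_def
  proof (rule sum_mono)
    fix s assume s: "s \<in> S"
    let ?m = "\<Sum>\<omega>\<in>UNIV. \<mu> $ \<omega> * \<pi> \<omega> s"
    let ?q = "p s * of_bool (p s \<le> cost A u (posterior \<theta> \<pi> s))"
    have m: "?m = \<phi> s * likelihood_ratio \<mu> \<theta> (\<eta> s)"
      using scheme[OF s] by (simp add: sum_induced_scheme)
    show "?m * ?q \<le> \<phi> s * likelihood_ratio \<mu> \<theta> (\<eta> s) * cost A u (\<eta> s)"
    proof (cases "\<phi> s = 0")
      case False
      \<comment> \<open>Nonnegativity covers a refused offer, where \<open>?q\<close> is 0; an
        accepted price is at most the cost anyway.\<close>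
      have "0 \<le> cost A u (\<eta> s)"
        using simplex[OF s] assms(4,5) by (intro cost_nonneg prob_simplexD)
      then have "?q \<le> cost A u (\<eta> s)" using False by (simp add: \<eta>_def)
      moreover have "0 \<le> ?m"
        using assms(1) \<pi>(2)[OF s] by (intro sum_nonneg mult_nonneg_nonneg prob_simplexD)
      ultimately show ?thesis unfolding m[symmetric] by (intro mult_left_mono)
    qed (simp add: m)
  qed
  with feasible scheme show ?thesis by blast
qed

text \<open>Every rule is dominated by the objective of some decomposition, and every decomposition
  is a rule earning exactly its objective, so optimality passes both ways.\<close>

lemma solution_iff_optimal_rule:
  fixes S :: "'s set"
  assumes "\<mu> \<in> prob_simplex" "\<theta> \<in> prob_simplex" "\<forall>\<omega>. 0 < \<theta> $ \<omega>" "finite A" "A \<noteq> {}"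
    and "feasible \<theta> S \<eta> \<phi>"
  shows "solution \<mu> \<theta> A u S \<eta> \<phi> \<longleftrightarrow>
    optimal_rule \<mu> \<theta> A u S (induced_scheme \<theta> \<eta> \<phi>) (induced_price A u \<eta>)"
proof
  assume sol: "solution \<mu> \<theta> A u S \<eta> \<phi>"
  have "revenue \<mu> \<theta> A u S' \<pi> p \<le> objective \<mu> \<theta> A u S \<eta> \<phi>"
    if "advertising_rule S' \<pi> p" for S' :: "'s set" and \<pi> p
    using feasible_of_advertising_rule[OF assms(1-5) that, of u] sol
    unfolding solution_def by (meson order_trans)
  then show "optimal_rule \<mu> \<theta> A u S (induced_scheme \<theta> \<eta> \<phi>) (induced_price A u \<eta>)"
    using assms(3,6) by (simp add: optimal_rule_def advertising_rule_induced revenue_induced)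
next
  assume opt: "optimal_rule \<mu> \<theta> A u S (induced_scheme \<theta> \<eta> \<phi>) (induced_price A u \<eta>)"
  have "objective \<mu> \<theta> A u S' \<eta>' \<phi>' \<le> objective \<mu> \<theta> A u S \<eta> \<phi>"
    if "feasible \<theta> S' \<eta>' \<phi>'" for S' :: "'s set" and \<eta>' \<phi>'
    using opt assms(3,6) that advertising_rule_induced revenue_induced
    unfolding optimal_rule_def by metis
  then show "solution \<mu> \<theta> A u S \<eta> \<phi>"
    using assms(6) by (simp add: solution_def)
qed

text \<open>Feasibility does not state this normalization; comparing total masses in the barycentre
  equation gives it. It makes a decomposition a genuine convex combination.\<close>

lemma sum_weights_feasible:
  assumes "\<theta> \<in> prob_simplex" "feasible \<theta> S \<eta> \<phi>"
  shows "sum \<phi> S = 1"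
proof -
  have "1 = (\<Sum>\<omega>\<in>UNIV. (\<Sum>s\<in>S. \<phi> s *\<^sub>R \<eta> s) $ \<omega>)"
    using assms by (simp add: feasible_def prob_simplexD)
  also have "\<dots> = (\<Sum>s\<in>S. \<phi> s * (\<Sum>\<omega>\<in>UNIV. \<eta> s $ \<omega>))"
    unfolding sum_distrib_left by (subst sum.swap) simp
  also have "\<dots> = sum \<phi> S"
    using assms(2) by (intro sum.cong) (auto simp: feasible_def prob_simplexD)
  finally show ?thesis by simp
qed

theorem proposition3p1:
  fixes \<mu> \<theta> :: "real^'n" and A :: "'a set" and u :: "'n \<Rightarrow> 'a \<Rightarrow> real"
  assumes "\<mu> \<in> prob_simplex"
    and "\<theta> \<in> prob_simplex" and "\<forall>\<omega>. 0 < \<theta> $ \<omega>"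
    and "finite A" and "A \<noteq> {}"
    and "\<forall>\<omega>. \<forall>a\<in>A. u \<omega> a \<in> {0..1}"
  shows "(\<exists>F. is_concave_closure_on prob_simplex
               (\<lambda>\<eta>. likelihood_ratio \<mu> \<theta> \<eta> * cost A u \<eta>) F \<and>
             (\<exists>(S :: 's::infinite set) \<pi> p.
                optimal_rule \<mu> \<theta> A u S \<pi> p \<and> revenue \<mu> \<theta> A u S \<pi> p = F \<theta>) \<and>
             (\<exists>(S :: 's set) \<eta> \<phi>.
                solution \<mu> \<theta> A u S \<eta> \<phi> \<and> objective \<mu> \<theta> A u S \<eta> \<phi> = F \<theta>)) \<and>
         (\<forall>(S :: 's set) \<eta> \<phi>. feasible \<theta> S \<eta> \<phi> \<longrightarrow>
             advertising_rule S (induced_scheme \<theta> \<eta> \<phi>) (induced_price A u \<eta>) \<and>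
             revenue \<mu> \<theta> A u S (induced_scheme \<theta> \<eta> \<phi>) (induced_price A u \<eta>)
               = objective \<mu> \<theta> A u S \<eta> \<phi> \<and>
             (solution \<mu> \<theta> A u S \<eta> \<phi> \<longleftrightarrow>
                optimal_rule \<mu> \<theta> A u S (induced_scheme \<theta> \<eta> \<phi>) (induced_price A u \<eta>))) \<and>
         (\<forall>(S :: 's set) \<pi> p. advertising_rule S \<pi> p \<longrightarrow>
             (\<exists>\<eta> \<phi>. feasible \<theta> S \<eta> \<phi> \<and>
                (\<forall>\<omega>. \<forall>s\<in>S. \<pi> \<omega> s = induced_scheme \<theta> \<eta> \<phi> \<omega> s) \<and>
                revenue \<mu> \<theta> A u S \<pi> p \<le> objective \<mu> \<theta> A u S \<eta> \<phi> \<and>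
                (optimal_rule \<mu> \<theta> A u S \<pi> p \<longrightarrow> solution \<mu> \<theta> A u S \<eta> \<phi>)))"
proof (intro conjI allI impI)
  let ?f = "\<lambda>\<eta>. likelihood_ratio \<mu> \<theta> \<eta> * cost A u \<eta>"
  let ?H = "convex hull ((\<lambda>\<eta>. (\<eta>, ?f \<eta>)) ` prob_simplex)"
  have "continuous_on prob_simplex ?f"
    using assms(4,5) by (intro continuous_intros continuous_on_likelihood_ratio continuous_on_cost)
  then obtain F where F: "is_concave_closure_on prob_simplex ?f F"
    "\<And>\<eta>. \<eta> \<in> prob_simplex \<Longrightarrow> (\<eta>, F \<eta>) \<in> ?H" "\<And>\<eta> y. (\<eta>, y) \<in> ?H \<Longrightarrow> y \<le> F \<eta>"
    using concave_closure_attained[OF compact_prob_simplex convex_prob_simplex] by blast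
  have upper: "objective \<mu> \<theta> A u S \<eta> \<phi> \<le> F \<theta>" if "feasible \<theta> S \<eta> \<phi>" for S :: "'s set" and \<eta> \<phi>
  proof -
    \<comment> \<open>This convex combination of graph points lies above \<theta>, at a height equal
      to the objective.\<close>
    have "(\<Sum>s\<in>S. \<phi> s *\<^sub>R (\<eta> s, ?f (\<eta> s))) \<in> ?H"
      using that sum_weights_feasible[OF assms(2) that]
      by (intro convex_sum hull_inc) (auto simp: feasible_def)
    also have "(\<Sum>s\<in>S. \<phi> s *\<^sub>R (\<eta> s, ?f (\<eta> s))) = (\<theta>, objective \<mu> \<theta> A u S \<eta> \<phi>)"
      using that by (simp add: prod_eq_iff fst_sum snd_sum feasible_def objective_def mult.assoc)
    finally show ?thesis by (rule F(3))
  qed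
  \<comment> \<open>Decomposing the top point of the hull above \<theta> into graph points gives the
    maximizer; the posteriors are their first coordinates.\<close>
  obtain S0 :: "'s set" and w y where S0: "finite S0"
    "\<forall>s\<in>S0. 0 \<le> w s \<and> y s \<in> (\<lambda>\<eta>. (\<eta>, ?f \<eta>)) ` prob_simplex"
    "(\<Sum>s\<in>S0. w s *\<^sub>R y s) = (\<theta>, F \<theta>)"
    using convex_hull_indexed_by_infinite_type[OF F(2)[OF assms(2)]] by blast
  define \<eta>0 where "\<eta>0 = fst \<circ> y"
  have y: "\<eta>0 s \<in> prob_simplex" "snd (y s) = ?f (\<eta>0 s)" if "s \<in> S0" for s
    using S0(2) that by (auto simp: \<eta>0_def)
  have feas0: "feasible \<theta> S0 \<eta>0 w"
    using S0(1,2) y(1) arg_cong[OF S0(3), of fst] by (simp add: feasible_def \<eta>0_def fst_sum)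
  have obj0: "objective \<mu> \<theta> A u S0 \<eta>0 w = F \<theta>"
    using arg_cong[OF S0(3), of snd] y(2) by (simp add: objective_def snd_sum mult.assoc)
  have sol0: "solution \<mu> \<theta> A u S0 \<eta>0 w"
    using feas0 obj0 upper by (simp add: solution_def)
  then have opt0: "optimal_rule \<mu> \<theta> A u S0 (induced_scheme \<theta> \<eta>0 w) (induced_price A u \<eta>0)"
    using solution_iff_optimal_rule[OF assms(1-5) feas0] by simp
  show "\<exists>F. is_concave_closure_on prob_simplex ?f F \<and>
      (\<exists>(S :: 's set) \<pi> p. optimal_rule \<mu> \<theta> A u S \<pi> p \<and> revenue \<mu> \<theta> A u S \<pi> p = F \<theta>) \<and>
      (\<exists>(S :: 's set) \<eta> \<phi>. solution \<mu> \<theta> A u S \<eta> \<phi> \<and> objective \<mu> \<theta> A u S \<eta> \<phi> = F \<theta>)"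
    using F(1) sol0 opt0 obj0 revenue_induced[OF assms(3) feas0] by metis
next
  fix S :: "'s set" and \<eta> \<phi>
  assume feas: "feasible \<theta> S \<eta> \<phi>"
  show "advertising_rule S (induced_scheme \<theta> \<eta> \<phi>) (induced_price A u \<eta>)"
    using assms(3) feas by (rule advertising_rule_induced)
  show "revenue \<mu> \<theta> A u S (induced_scheme \<theta> \<eta> \<phi>) (induced_price A u \<eta>)
      = objective \<mu> \<theta> A u S \<eta> \<phi>"
    using assms(3) feas by (rule revenue_induced)
  show "solution \<mu> \<theta> A u S \<eta> \<phi> \<longleftrightarrow>
      optimal_rule \<mu> \<theta> A u S (induced_scheme \<theta> \<eta> \<phi>) (induced_price A u \<eta>)"
    using assms(1-5) feas by (rule solution_iff_optimal_rule)
next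
  fix S :: "'s set" and \<pi> :: "'n \<Rightarrow> 's \<Rightarrow> real" and p
  assume "advertising_rule S \<pi> p"
  then obtain \<eta> \<phi> where *: "feasible \<theta> S \<eta> \<phi>"
    "\<forall>\<omega>. \<forall>s\<in>S. \<pi> \<omega> s = induced_scheme \<theta> \<eta> \<phi> \<omega> s"
    "revenue \<mu> \<theta> A u S \<pi> p \<le> objective \<mu> \<theta> A u S \<eta> \<phi>"
    using feasible_of_advertising_rule[OF assms(1-5), of S \<pi> p u] by blast
  have "solution \<mu> \<theta> A u S \<eta> \<phi>" if "optimal_rule \<mu> \<theta> A u S \<pi> p"
  proof -
    \<comment> \<open>Replacing the prices of an optimal rule by the costs loses no revenue, so the
      induced rule is optimal too.\<close>
    have "revenue \<mu> \<theta> A u S' \<pi>' p' \<le> objective \<mu> \<theta> A u S \<eta> \<phi>"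
      if "advertising_rule S' \<pi>' p'" for S' :: "'s set" and \<pi>' p'
      using *(3) that \<open>optimal_rule \<mu> \<theta> A u S \<pi> p\<close> unfolding optimal_rule_def by (meson order_trans)
    then have "optimal_rule \<mu> \<theta> A u S (induced_scheme \<theta> \<eta> \<phi>) (induced_price A u \<eta>)"
      using assms(3) *(1)
      by (simp add: optimal_rule_def advertising_rule_induced revenue_induced)
    then show ?thesis
      using solution_iff_optimal_rule[OF assms(1-5) *(1)] by simp
  qed
  with * show "\<exists>\<eta> \<phi>. feasible \<theta> S \<eta> \<phi> \<and>
      (\<forall>\<omega>. \<forall>s\<in>S. \<pi> \<omega> s = induced_scheme \<theta> \<eta> \<phi> \<omega> s) \<and>
      revenue \<mu> \<theta> A u S \<pi> p \<le> objective \<mu> \<theta> A u S \<eta> \<phi> \<and>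
      (optimal_rule \<mu> \<theta> A u S \<pi> p \<longrightarrow> solution \<mu> \<theta> A u S \<eta> \<phi>)"
    by blast
qed

end
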